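(* Let $p$ be a prime, and let $\alpha,\beta,a,n,r$ be integers for which $$\alpha>1,\quad \alpha\geq\beta\geq0,\quad a\equiv 1\ (\mathrm{mod}\ p^{\alpha}),\quad n\geq p^{\alpha-1}\quad\text{and}\quad r<p^{\beta}.$$ Then $$\sum_{k\equiv r\ (\mathrm{mod}\ p^{\beta})}\binom nk(-1)^ka^{\left\lfloor\frac{k-r}{p^{\alpha}}\right\rfloor}\equiv0\ \left(\mathrm{mod}\ p^{\left\lfloor\frac{n-p^{\alpha-1}-\delta_{\beta,0}}{\varphi(p^{\alpha})}\right\rfloor+\alpha-\beta}\right).$$
   Context: $\varphi$ is Euler's totient function and $\lfloor\cdot\rfloor$ is the floor function. $\delta_{m,n}$ is $1$ if $m=n$ and $0$ otherwise. The sum runs over the integers $k$ with $0\leq k\leq n$ in the given residue class (for other integers $k$ one has $\binom nk=0$, so those terms are zero). *)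

theory Defs
  imports "HOL-Number_Theory.Number_Theory"
begin

definition kronecker_delta :: "nat \<Rightarrow> nat \<Rightarrow> int" where
  "kronecker_delta m n = (if m = n then 1 else 0)"

text \<open>
  On type \<^typ>\<open>int\<close>, \<open>div\<close> is division rounded towards minus infinity, so \<open>x div y\<close>
  is the floor of the rational number \<open>x / y\<close>.  Powers of integers take exponents of type
  \<^typ>\<open>nat\<close>, so integer exponents are converted with \<^const>\<open>nat\<close>, which sends
  negative numbers to 0.  The next two facts show that the exponents concerned are never
  negative, so that the conversion changes nothing.
\<close>

lemma exponent_nonneg:
  fixes p \<alpha> \<beta> k :: nat and r :: int
  assumes "prime p" and "\<beta> \<le> \<alpha>" and "r < int p ^ \<beta>" and "[int k = r] (mod int p ^ \<beta>)"
  shows "(int k - r) div int p ^ \<alpha> \<ge> 0"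
proof -
  from assms(4) obtain c where c: "int k - r = int p ^ \<beta> * c"
    by (auto simp: cong_iff_dvd_diff dvd_def)
  have pos: "int p ^ \<beta> > 0"
    using assms(1) by (simp add: prime_gt_0_nat)
  have "int p ^ \<beta> * (-1) < int p ^ \<beta> * c"
    using assms(3) c by linarith
  then have "-1 < c"
    using mult_less_cancel_left_pos[OF pos] by blast
  then have "c \<ge> 0"
    by simp
  then have "int k - r \<ge> 0"
    using c pos by simp
  then show ?thesis
    by (simp add: pos_imp_zdiv_nonneg_iff assms(1) prime_gt_0_nat)
qed

lemma modulus_exponent_nonneg:
  fixes p \<alpha> \<beta> n :: nat
  assumes "prime p" and "\<alpha> > 1" and "\<beta> \<le> \<alpha>" and "n \<ge> p ^ (\<alpha> - 1)"
  shows "(int n - int p ^ (\<alpha> - 1) - kronecker_delta \<beta> 0) div int (totient (p ^ \<alpha>))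
           + int \<alpha> - int \<beta> \<ge> 0"
proof -
  have tot: "int (totient (p ^ \<alpha>)) > 0"
    using assms(1) by (simp add: prime_gt_0_nat)
  have n: "int n - int p ^ (\<alpha> - 1) \<ge> 0"
    using assms(4) by (metis diff_ge_0_iff_ge of_nat_le_iff of_nat_power)
  show ?thesis
  proof (cases "\<beta> = 0")
    case True
    have "(-1) div int (totient (p ^ \<alpha>))
            \<le> (int n - int p ^ (\<alpha> - 1) - 1) div int (totient (p ^ \<alpha>))"
      using n tot by (intro zdiv_mono1; linarith)
    moreover have "(-1) div int (totient (p ^ \<alpha>)) = -1"
      using tot by (rule div_eq_minus1)
    ultimately show ?thesis
      using True assms(2) by (simp add: kronecker_delta_def)
  next
    case False
    have "(int n - int p ^ (\<alpha> - 1)) div int (totient (p ^ \<alpha>)) \<ge> 0"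
      using n tot pos_imp_zdiv_nonneg_iff by blast
    then show ?thesis
      using False assms(3) by (simp add: kronecker_delta_def)
  qed
qed

end

theory Submission
  imports Defs "HOL-Computational_Algebra.Polynomial"
begin

text \<open>
  Write $P = p^\alpha$, $u = 1 - X$, $v_i = 1 - X^{p^i}$.  The sum is the value at $u^n$ of the
  linear functional $X^m \mapsto w(m)$ on $\mathbb{Z}[X]$, where $w(m) = a^{\lfloor (m-r)/P \rfloor}$
  if $m \equiv r$ modulo $p^\beta$ and $w(m) = 0$ otherwise; it satisfies $w(m + P) = a\, w(m)$.
  Since $u^{\varphi(p^{i+1})} v_i = v_{i+1} + p\, g\, v_i$, the ideal $J$ generated by
  $p^{\alpha-1-i} v_i$ (for $\beta \le i < \alpha$) and $p^{\alpha-\beta}$ contains $u^{p^{\alpha-1}}$ and,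
  modulo $X^P - a$, satisfies $u^{\varphi(P)} J \subseteq p J$ as long as $0 < \beta < \alpha$.
  The functional maps $J$ into multiples of $p^{\alpha-\beta}$, which gives the claim.
  For $\beta = \alpha$ the ideal of $\alpha - 1$ suffices.  For $\beta = 0$, one factor $u$ is traded for
  a factor $1 - a$, divisible by $p^\alpha$, which leaves a functional of the kind $\beta = \alpha$;
  this is the origin of the Kronecker delta.
\<close>

section \<open>The linear functional on integer polynomials attached to a weight\<close>

definition wsum :: "(nat \<Rightarrow> int) \<Rightarrow> int poly \<Rightarrow> int" where
  "wsum w f = (\<Sum>m\<le>degree f. coeff f m * w m)"

text \<open>Allows polynomials of different degrees to be evaluated over one common range, as
  additivity requires.\<close>

lemma wsum_eq_sum:
  assumes "degree f \<le> d"
  shows "wsum w f = (\<Sum>m\<le>d. coeff f m * w m)"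
  unfolding wsum_def using assms
  by (intro sum.mono_neutral_left) (auto simp: coeff_eq_0)

lemma wsum_add: "wsum w (f + g) = wsum w f + wsum w g"
proof -
  define d where "d = max (degree f) (degree g)"
  have "degree (f + g) \<le> d" "degree f \<le> d" "degree g \<le> d"
    by (auto simp: d_def degree_add_le)
  then show ?thesis
    by (simp add: wsum_eq_sum[of _ d] sum.distrib ring_distribs)
qed

lemma wsum_smult: "wsum w (smult c f) = c * wsum w f"
  by (cases "c = 0") (simp_all add: wsum_def sum_distrib_left mult.assoc)

lemma wsum_minus: "wsum w (- f) = - wsum w f"
  by (simp add: wsum_def sum_negf)

lemma wsum_diff: "wsum w (f - g) = wsum w f - wsum w g"
  using wsum_add[of w f "- g"] by (simp add: wsum_minus)

lemma wsum_sum: "wsum w (\<Sum>k\<in>A. f k) = (\<Sum>k\<in>A. wsum w (f k))"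
  by (induction A rule: infinite_finite_induct) (simp_all add: wsum_add, simp_all add: wsum_def)

lemma wsum_weight_diff: "wsum (\<lambda>m. w m - w' m) f = wsum w f - wsum w' f"
  by (simp add: wsum_def sum_subtractf right_diff_distrib)

lemma wsum_weight_mult: "wsum (\<lambda>m. c * w m) f = c * wsum w f"
  by (simp add: wsum_def sum_distrib_left mult_ac)

lemma wsum_monom: "wsum w (monom c k) = c * w k"
proof -
  have "wsum w (monom c k) = (\<Sum>m\<le>k. coeff (monom c k) m * w m)"
    by (intro wsum_eq_sum degree_monom_le)
  also have "\<dots> = (\<Sum>m\<in>{k}. coeff (monom c k) m * w m)"
    by (intro sum.mono_neutral_right) auto
  finally show ?thesis by simp
qed

lemma wsum_monom_mult: "wsum w (monom 1 k * f) = wsum (\<lambda>m. w (m + k)) f"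
proof -
  have "monom 1 k * f = monom 1 k * (\<Sum>i\<le>degree f. monom (coeff f i) i)"
    by (simp add: poly_as_sum_of_monoms)
  also have "\<dots> = (\<Sum>i\<le>degree f. monom (coeff f i) (i + k))"
    by (simp add: sum_distrib_left mult_monom add.commute)
  finally show ?thesis
    by (simp add: wsum_sum wsum_monom wsum_def[of _ f])
qed

lemma dvd_wsum: "(\<And>m. d dvd w m) \<Longrightarrow> d dvd wsum w f"
  unfolding wsum_def by (intro dvd_sum) simp

text \<open>In the notation above, \<open>one_minus_X 1\<close> is u and
  \<open>one_minus_X (p ^ i)\<close> is v_i.\<close>

definition one_minus_X :: "nat \<Rightarrow> int poly" where
  "one_minus_X k = 1 - monom 1 k"

text \<open>Multiplication by X^k shifts the weight, so a factor 1 - X^k acts as a difference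
  operator. Divisibility on all multiples of v_i can thus be read off the weight.\<close>

lemma wsum_one_minus_X_mult:
  "wsum w (one_minus_X k * f) = wsum (\<lambda>m. w m - w (m + k)) f"
  by (simp add: one_minus_X_def left_diff_distrib wsum_diff wsum_monom_mult wsum_weight_diff)

lemma wsum_one_minus_X_power:
  "wsum w (one_minus_X 1 ^ n) = (\<Sum>k\<le>n. int (n choose k) * (-1) ^ k * w k)"
proof -
  have "one_minus_X 1 ^ n = (monom (-1) 1 + 1) ^ n"
    by (simp add: one_minus_X_def minus_monom[symmetric])
  also have "\<dots> = (\<Sum>k\<le>n. smult (int (n choose k)) (monom ((-1) ^ k) k))"
    by (simp add: binomial_ring monom_power of_nat_poly mult.commute)
  finally show ?thesis
    by (simp add: wsum_sum wsum_smult wsum_monom mult.assoc)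
qed

section \<open>Powers of 1 - X modulo a prime\<close>

lemma prime_dvd_binomial_power:
  fixes f g :: "'a :: comm_ring_1"
  assumes "prime p"
  shows "of_nat p dvd (f + g) ^ p - f ^ p - g ^ p"
proof -
  have p: "p > 0" using assms prime_gt_0_nat by blast
  define h where "h k = of_nat (p choose k) * f ^ k * g ^ (p - k)" for k
  have "{..p} = insert 0 (insert p {1..<p})" using p by auto
  moreover have "(f + g) ^ p = (\<Sum>k\<le>p. h k)" by (simp add: binomial_ring h_def)
  ultimately have "(f + g) ^ p - f ^ p - g ^ p = (\<Sum>k\<in>{1..<p}. h k)"
    using p by (simp add: h_def)
  moreover have "of_nat p dvd h k" if "k \<in> {1..<p}" for k
  proof -
    have "p dvd (p choose k)" using that assms by (intro dvd_choose_prime) auto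
    then have "(of_nat p :: 'a) dvd of_nat (p choose k)" by (auto elim!: dvdE)
    then show ?thesis by (simp add: h_def)
  qed
  ultimately show ?thesis by (simp only: dvd_sum)
qed

text \<open>Splitting 1 as (1 - f) + f avoids the sign of (-f)^p, so p = 2 needs no separate
  case.\<close>

lemma prime_dvd_one_minus_power:
  fixes f :: "'a :: comm_ring_1"
  assumes "prime p"
  shows "of_nat p dvd (1 - f) ^ p - (1 - f ^ p)"
proof -
  have "of_nat p dvd - ((1 - f + f) ^ p - (1 - f) ^ p - f ^ p)"
    using prime_dvd_binomial_power[OF assms, of "1 - f" f] dvd_minus_iff by blast
  then show ?thesis by (simp add: algebra_simps)
qed

lemma dvd_power_diff: "d dvd f - g \<Longrightarrow> d dvd f ^ n - g ^ n" for f g :: "'a :: comm_ring_1"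
  unfolding power_diff_sumr2 by (rule dvd_mult2)

lemma one_minus_X_frobenius:
  assumes "prime p"
  shows "of_nat p dvd one_minus_X 1 ^ (p ^ i) - one_minus_X (p ^ i)"
proof (induction i)
  case (Suc i)
  have "of_nat p dvd (one_minus_X 1 ^ (p ^ i)) ^ p - one_minus_X (p ^ i) ^ p"
    using Suc dvd_power_diff by blast
  moreover have "of_nat p dvd one_minus_X (p ^ i) ^ p - one_minus_X (p ^ Suc i)"
    using prime_dvd_one_minus_power[OF assms, of "monom 1 (p ^ i) :: int poly"]
    by (simp add: one_minus_X_def monom_power mult.commute)
  ultimately have "of_nat p dvd (one_minus_X 1 ^ (p ^ i)) ^ p - one_minus_X (p ^ i) ^ p
      + (one_minus_X (p ^ i) ^ p - one_minus_X (p ^ Suc i))"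
    by (rule dvd_add)
  then show ?case
    by (simp add: power_mult[symmetric] mult.commute)
qed simp

text \<open>Put y = X^(p^i) and T = 1 + y + ... + y^(p-1), so that (1 - y) T = v_(i+1). Modulo p,
  both u^(p^i (p-1)) and T become u^(p^(i+1)) when multiplied by u^(p^i). As p is a prime element of
  Z[X] not dividing u, this factor cancels and the two agree modulo p; multiplying by v_i gives the
  identity.\<close>

lemma one_minus_X_step:
  assumes "prime p"
  obtains g where "one_minus_X 1 ^ (p ^ i * (p - 1)) * one_minus_X (p ^ i)
    = one_minus_X (p ^ Suc i) + smult (int p) (g * one_minus_X (p ^ i))"
proof -
  define u where "u = one_minus_X 1"
  define y where "y = (monom 1 (p ^ i) :: int poly)"
  define T where "T = (\<Sum>j<p. y ^ j)"
  define v where "v = u ^ (p ^ i * (p - 1))"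
  have y: "one_minus_X (p ^ i) = 1 - y" by (simp add: one_minus_X_def y_def)
  have T: "(1 - y) * T = one_minus_X (p ^ Suc i)"
    unfolding T_def one_diff_power_eq[symmetric]
    by (simp add: one_minus_X_def y_def monom_power mult.commute)
  have p: "p > 0" using assms prime_gt_0_nat by blast
  have e: "u ^ (p ^ i) * v = u ^ (p ^ Suc i)"
    using p by (simp add: v_def power_add[symmetric] mult.commute algebra_simps)
  have "of_nat p dvd u ^ (p ^ Suc i) - (1 - y) * T"
    using one_minus_X_frobenius[OF assms, of "Suc i"] T u_def by simp
  moreover have "of_nat p dvd (u ^ (p ^ i) - (1 - y)) * T"
    using one_minus_X_frobenius[OF assms, of i] y u_def by simp
  ultimately have "of_nat p dvd u ^ (p ^ Suc i) - (1 - y) * T - (u ^ (p ^ i) - (1 - y)) * T"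
    by (rule dvd_diff)
  then have "of_nat p dvd u ^ (p ^ i) * (v - T)"
    unfolding e[symmetric] by (simp add: left_diff_distrib right_diff_distrib)
  moreover have "prime_elem (of_nat p :: int poly)"
    using assms by (simp add: of_nat_poly prime_elem_const_poly_iff)
  moreover have "\<not> (of_nat p :: int poly) dvd u"
  proof
    assume "(of_nat p :: int poly) dvd u"
    then have "int p dvd coeff u 0"
      by (simp add: of_nat_poly const_poly_dvd_iff)
    then show False
      using assms by (simp add: u_def one_minus_X_def)
  qed
  ultimately have "of_nat p dvd v - T"
    using prime_elem_dvd_mult_iff prime_elem_dvd_power by blast
  then obtain g where "v - T = of_nat p * g"
    by (rule dvdE)
  then have "v = T + of_nat p * g"
    by (simp add: diff_eq_eq add.commute)
  then have "v * (1 - y) = (1 - y) * T + smult (int p) (g * (1 - y))"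
    by (simp add: of_nat_poly algebra_simps)
  then show ?thesis using that T y u_def v_def by simp
qed

text \<open>Frobenius settles the exponent \<open>p ^ i\<close>; the leftover power of u goes into
  both cofactors.\<close>

lemma one_minus_X_power_split:
  assumes "prime p" "p ^ i \<le> k"
  obtains g h where "one_minus_X 1 ^ k = one_minus_X (p ^ i) * g + smult (int p) h"
proof -
  obtain h where "one_minus_X 1 ^ (p ^ i) - one_minus_X (p ^ i) = of_nat p * h"
    using one_minus_X_frobenius[OF assms(1), of i] by (rule dvdE)
  then have "one_minus_X 1 ^ (p ^ i) = one_minus_X (p ^ i) + of_nat p * h"
    by (simp add: diff_eq_eq add.commute)
  then have "one_minus_X 1 ^ k = (one_minus_X (p ^ i) + of_nat p * h) * one_minus_X 1 ^ (k - p ^ i)"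
    using assms(2) by (metis le_add_diff_inverse power_add)
  then show ?thesis
    by (intro that[of "one_minus_X 1 ^ (k - p ^ i)" "h * one_minus_X 1 ^ (k - p ^ i)"])
      (simp add: of_nat_poly algebra_simps)
qed

section \<open>Ideals of Z[X] and divisibility of the functional\<close>

definition poly_ideal :: "int poly set \<Rightarrow> bool" where
  "poly_ideal I \<longleftrightarrow> (\<forall>f\<in>I. \<forall>g\<in>I. f + g \<in> I) \<and> (\<forall>f\<in>I. \<forall>g. f * g \<in> I)"

lemma poly_ideal_combine:
  "poly_ideal I \<Longrightarrow> f \<in> I \<Longrightarrow> g \<in> I \<Longrightarrow> f * h + g * k \<in> I"
  by (auto simp: poly_ideal_def)

text \<open>With \<open>f = 1\<close> and \<open>j = \<alpha> - 1\<close> this is the membership of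
  u^(p^(\<alpha>-1)) in J. The free factor \<open>f\<close> drives the induction: u^(p^(j+1)) =
  u^(p^j) w with w = u^(p^j (p-1)), and the hypotheses at level j+1 for \<open>f\<close> imply those
  at level j for \<open>w * f\<close>.\<close>

lemma one_minus_X_power_in_ideal:
  assumes "prime p" "poly_ideal I" "b \<le> j"
    and "\<And>i. b \<le> i \<Longrightarrow> i \<le> j \<Longrightarrow> smult (int p ^ (j - i)) (one_minus_X (p ^ i)) * f \<in> I"
    and "smult (int p ^ (Suc j - b)) 1 * f \<in> I"
  shows "one_minus_X 1 ^ (p ^ j) * f \<in> I"
  using assms(3-)
proof (induction j arbitrary: f rule: dec_induct)
  case base
  obtain g h where e: "one_minus_X 1 ^ (p ^ b) = one_minus_X (p ^ b) * g + smult (int p) h"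
    using one_minus_X_power_split[OF assms(1) order_refl] by blast
  have "(one_minus_X (p ^ b) * f) * g + (smult (int p) 1 * f) * h \<in> I"
    using base.prems(1)[of b] base.prems(2) by (intro poly_ideal_combine assms(2)) simp_all
  then show ?case unfolding e by (simp add: algebra_simps)
next
  case (step j)
  define w where "w = one_minus_X 1 ^ (p ^ j * (p - 1))"
  have p: "p > 0" using assms(1) prime_gt_0_nat by blast
  have "one_minus_X 1 ^ (p ^ j) * (w * f) \<in> I"
  proof (rule step.IH)
    fix i assume i: "b \<le> i" "i \<le> j"
    obtain g where g: "one_minus_X 1 ^ (p ^ i * (p - 1)) * one_minus_X (p ^ i)
      = one_minus_X (p ^ Suc i) + smult (int p) (g * one_minus_X (p ^ i))"
      using one_minus_X_step[OF assms(1)] by blast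
    define h where "h = one_minus_X 1 ^ (p ^ j * (p - 1) - p ^ i * (p - 1))"
    have "w = one_minus_X 1 ^ (p ^ i * (p - 1)) * h"
      unfolding w_def h_def power_add[symmetric] using i p
      by (simp add: power_increasing)
    then have "smult (int p ^ (j - i)) (one_minus_X (p ^ i)) * (w * f) =
      smult (int p ^ (j - i)) (one_minus_X 1 ^ (p ^ i * (p - 1)) * one_minus_X (p ^ i)) * f * h"
      by (simp add: mult_ac)
    \<comment> \<open>The step identity trades v_i for v_(i+1) and p v_i, whose coefficients are
      exactly those of the generators at level j+1.\<close>
    also have "\<dots> = (smult (int p ^ (Suc j - Suc i)) (one_minus_X (p ^ Suc i)) * f) * h +
       (smult (int p ^ (Suc j - i)) (one_minus_X (p ^ i)) * f) * (g * h)"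
      unfolding g using i by (simp add: Suc_diff_le algebra_simps smult_add_right)
    also have "\<dots> \<in> I"
      using i by (intro poly_ideal_combine assms(2) step.prems) auto
    finally show "smult (int p ^ (j - i)) (one_minus_X (p ^ i)) * (w * f) \<in> I" .
  next
    have "1 \<le> p - 1" using prime_ge_2_nat[OF assms(1)] by simp
    then have "p ^ b \<le> p ^ j * (p - 1)"
      using step.hyps p by (metis mult.right_neutral mult_le_mono power_increasing Suc_leI One_nat_def)
    then obtain g h where e: "w = one_minus_X (p ^ b) * g + smult (int p) h"
      using one_minus_X_power_split[OF assms(1)] w_def by metis
    \<comment> \<open>The constant generator lacks one factor p; writing w as a multiple of v_b plus
      a multiple of p repairs this.\<close>
    have "smult (int p ^ (Suc j - b)) 1 * (w * f) =
      (smult (int p ^ (Suc j - b)) (one_minus_X (p ^ b)) * f) * g + (smult (int p ^ (Suc (Suc j) - b)) 1 * f) * h"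
      using step.hyps by (simp add: e Suc_diff_le algebra_simps smult_add_right)
    also have "\<dots> \<in> I"
      using step.hyps by (intro poly_ideal_combine assms(2) step.prems) auto
    finally show "smult (int p ^ (Suc j - b)) 1 * (w * f) \<in> I" .
  qed
  moreover have "p ^ j + p ^ j * (p - 1) = p ^ Suc j" using p by (simp add: algebra_simps)
  ultimately show ?case by (simp add: w_def power_add[symmetric] mult.assoc[symmetric])
qed

text \<open>The largest ideal on which the functional takes only multiples of \<open>d\<close>;
  quantifying over the cofactor \<open>g\<close> makes it an ideal.\<close>

definition wsum_ideal :: "(nat \<Rightarrow> int) \<Rightarrow> int \<Rightarrow> int poly set" where
  "wsum_ideal w d = {f. \<forall>g. d dvd wsum w (f * g)}"

lemma poly_ideal_wsum_ideal: "poly_ideal (wsum_ideal w d)"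
  by (auto simp: poly_ideal_def wsum_ideal_def wsum_add ring_distribs mult.assoc)

lemma smult_in_wsum_ideal:
  "f \<in> wsum_ideal w d \<Longrightarrow> smult c f \<in> wsum_ideal w (c * d)"
  by (auto simp: wsum_ideal_def wsum_smult)

text \<open>Each factor u^\<phi>(P) gains one factor p on the generators of J, and the remaining
  u^(p^(\<alpha>-1)) lies in J. The parameter \<open>e\<close> is the divisibility available before
  any gain: \<open>\<alpha> - \<beta>\<close> in the main case, 0 in the boundary case.\<close>

lemma wsum_power_dvd:
  assumes "prime p" "0 < b" "b < \<alpha>" "e \<le> \<alpha> - b"
    and a: "int p ^ \<alpha> dvd 1 - a"
    and w: "\<And>m. w (m + p ^ \<alpha>) = a * w m"
    and base: "\<And>i m. b \<le> i \<Longrightarrow> i < \<alpha> \<Longrightarrow> int p ^ e dvd int p ^ (\<alpha> - 1 - i) * (w m - w (m + p ^ i))"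
    and n: "p ^ (\<alpha> - 1) + t * (p ^ (\<alpha> - 1) * (p - 1)) \<le> n"
  shows "int p ^ (t + e) dvd wsum w (one_minus_X 1 ^ n)"
proof -
  define u where "u = one_minus_X 1"
  define \<phi> where "\<phi> = p ^ (\<alpha> - 1) * (p - 1)"
  have p: "p \<ge> 2" using assms(1) prime_ge_2_nat by blast
  let ?N = "\<lambda>t. wsum_ideal w (int p ^ (t + e))"
  note N_combine = poly_ideal_combine[OF poly_ideal_wsum_ideal]
  have N_Suc: "smult (int p) f \<in> ?N (Suc t)" if "f \<in> ?N t" for f t
    using smult_in_wsum_ideal[OF that] by simp
  \<comment> \<open>Invariant: every generator of J, times u^(t \<phi>), lies in the ideal for
    p^(t+e).\<close>
  have main: "(\<forall>i. b \<le> i \<and> i < \<alpha> \<longrightarrow> smult (int p ^ (\<alpha> - 1 - i)) (one_minus_X (p ^ i)) * u ^ (t * \<phi>) \<in> ?N t)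
    \<and> smult (int p ^ (\<alpha> - b)) 1 * u ^ (t * \<phi>) \<in> ?N t" for t
  proof (induction t)
    case 0
    have "int p ^ e dvd int p ^ (\<alpha> - b)" using assms(4) by (rule le_imp_power_dvd)
    then show ?case
      using base
      by (auto simp: wsum_ideal_def wsum_smult wsum_one_minus_X_mult wsum_weight_mult[symmetric] intro!: dvd_wsum)
  next
    case (Suc t)
    have u: "u ^ (Suc t * \<phi>) = u ^ \<phi> * u ^ (t * \<phi>)" by (simp add: power_add)
    have "smult (int p ^ (\<alpha> - 1 - i)) (one_minus_X (p ^ i)) * u ^ (Suc t * \<phi>) \<in> ?N (Suc t)"
      if i: "b \<le> i" "i < \<alpha>" for i
    proof -
      obtain g where g: "u ^ (p ^ i * (p - 1)) * one_minus_X (p ^ i)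
        = one_minus_X (p ^ Suc i) + smult (int p) (g * one_minus_X (p ^ i))"
        using one_minus_X_step[OF assms(1)] u_def by blast
      define h where "h = u ^ (\<phi> - p ^ i * (p - 1))"
      have "u ^ \<phi> = u ^ (p ^ i * (p - 1)) * h"
        unfolding \<phi>_def h_def power_add[symmetric] using i p
        by (simp add: power_increasing)
      then have "smult (int p ^ (\<alpha> - 1 - i)) (one_minus_X (p ^ i)) * u ^ (Suc t * \<phi>) =
          smult (int p ^ (\<alpha> - 1 - i)) (u ^ (p ^ i * (p - 1)) * one_minus_X (p ^ i)) * u ^ (t * \<phi>) * h"
        unfolding u by (simp add: mult_ac)
      \<comment> \<open>The second summand shows its new factor p. In the first, the coefficient of
        v_(i+1) is p times that of its generator, unless i + 1 = \<alpha>, where v_\<alpha> is not a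
        generator.\<close>
      also have "\<dots> = (smult (int p ^ (\<alpha> - 1 - i)) (one_minus_X (p ^ Suc i)) * u ^ (t * \<phi>)) * h +
         smult (int p) (smult (int p ^ (\<alpha> - 1 - i)) (one_minus_X (p ^ i)) * u ^ (t * \<phi>)) * (g * h)"
        unfolding g by (simp add: algebra_simps smult_add_right)
      also have "\<dots> \<in> ?N (Suc t)"
      proof (intro N_combine)
        show "smult (int p) (smult (int p ^ (\<alpha> - 1 - i)) (one_minus_X (p ^ i)) * u ^ (t * \<phi>)) \<in> ?N (Suc t)"
          using Suc i by (intro N_Suc) blast
        show "smult (int p ^ (\<alpha> - 1 - i)) (one_minus_X (p ^ Suc i)) * u ^ (t * \<phi>) \<in> ?N (Suc t)"
        proof (cases "Suc i = \<alpha>")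
          case False
          then have "smult (int p) (smult (int p ^ (\<alpha> - 1 - Suc i)) (one_minus_X (p ^ Suc i)) * u ^ (t * \<phi>)) \<in> ?N (Suc t)"
            using i by (intro N_Suc conjunct1[OF Suc, rule_format]) auto
          moreover have "\<alpha> - 1 - i = Suc (\<alpha> - 1 - Suc i)" using False i by simp
          ultimately show ?thesis by simp
        next
          case True
          \<comment> \<open>On the functional, v_\<alpha> acts as the scalar 1 - a. Its divisor
            p^\<alpha> contains p p^(\<alpha>-b) because b > 0: the gained factor times the constant
            generator.\<close>
          obtain c where c: "1 - a = int p ^ \<alpha> * c" using a by (rule dvdE)
          have "int p ^ \<alpha> = int p * int p ^ (b - 1) * int p ^ (\<alpha> - b)"
            using assms(2,3) by (simp flip: power_Suc power_add)
          then have "1 - a = int p * int p ^ (\<alpha> - b) * (int p ^ (b - 1) * c)"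
            using c by (simp add: mult_ac)
          then have eq: "(1 - a) * x = int p * (int p ^ (\<alpha> - b) * x) * (int p ^ (b - 1) * c)" for x
            by (simp add: mult_ac)
          have "int p ^ (t + e) dvd int p ^ (\<alpha> - b) * wsum w (u ^ (t * \<phi>) * g)" for g
            using Suc by (auto simp: wsum_ideal_def wsum_smult)
          then have "int p ^ (Suc t + e) dvd (1 - a) * wsum w (u ^ (t * \<phi>) * g)" for g
            unfolding eq add_Suc power_Suc by (rule dvd_mult2[OF mult_dvd_mono[OF dvd_refl]])
          moreover have "wsum w (one_minus_X (p ^ \<alpha>) * f) = (1 - a) * wsum w f" for f
            by (simp add: wsum_one_minus_X_mult w left_diff_distrib flip: wsum_weight_mult)
          ultimately show ?thesis
            using True by (auto simp: wsum_ideal_def mult.assoc)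
        qed
      qed
      finally show ?thesis .
    qed
    moreover have "smult (int p ^ (\<alpha> - b)) 1 * u ^ (Suc t * \<phi>) \<in> ?N (Suc t)"
    proof -
      have "p ^ b * 1 \<le> \<phi>"
        unfolding \<phi>_def using assms(3) p by (intro mult_le_mono power_increasing) auto
      then obtain g h where e: "u ^ \<phi> = one_minus_X (p ^ b) * g + smult (int p) h"
        using one_minus_X_power_split[OF assms(1)] u_def by (metis mult.right_neutral)
      have "\<alpha> - b = Suc (\<alpha> - 1 - b)" using assms(3) by simp
      then have "smult (int p ^ (\<alpha> - b)) 1 * u ^ (Suc t * \<phi>) =
        smult (int p) (smult (int p ^ (\<alpha> - 1 - b)) (one_minus_X (p ^ b)) * u ^ (t * \<phi>)) * g
        + smult (int p) (smult (int p ^ (\<alpha> - b)) 1 * u ^ (t * \<phi>)) * h"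
        unfolding u e by (simp add: algebra_simps smult_add_right)
      also have "\<dots> \<in> ?N (Suc t)"
        using Suc assms(3) by (intro N_combine N_Suc) auto
      finally show ?thesis .
    qed
    ultimately show ?case by blast
  qed
  have "one_minus_X 1 ^ (p ^ (\<alpha> - 1)) * u ^ (t * \<phi>) \<in> ?N t"
    \<comment> \<open>Here the free factor is u^(t \<phi>) and j = \<alpha> - 1, so the hypotheses
      are the invariant itself.\<close>
    using main[of t] assms(3) by (intro one_minus_X_power_in_ideal[OF assms(1) poly_ideal_wsum_ideal, of b]) auto
  then have "int p ^ (t + e) dvd wsum w (u ^ (p ^ (\<alpha> - 1)) * u ^ (t * \<phi>) * u ^ (n - (p ^ (\<alpha> - 1) + t * \<phi>)))"
    by (auto simp: wsum_ideal_def u_def)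
  then show ?thesis
    using n by (simp add: u_def \<phi>_def flip: power_add)
qed

text \<open>Taking b = \<alpha> - 1 and e = 0 makes the condition on weight differences trivial, so
  only quasi-periodicity is left; b > 0 since \<alpha> > 1.\<close>

lemma wsum_power_dvd_top:
  assumes "prime p" "\<alpha> > 1" "int p ^ \<alpha> dvd 1 - a"
    and "\<And>m. w (m + p ^ \<alpha>) = a * w m"
    and "p ^ (\<alpha> - 1) + t * (p ^ (\<alpha> - 1) * (p - 1)) \<le> n"
  shows "int p ^ t dvd wsum w (one_minus_X 1 ^ n)"
  using wsum_power_dvd[of p "\<alpha> - 1" \<alpha> 0 a w t n] assms by simp

section \<open>The weights of the theorem and the cases for \<beta>\<close>

lemma power_diff_dvd: "d dvd 1 - a \<Longrightarrow> d dvd a ^ i - a ^ j" for a d :: int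
  using dvd_diff[OF dvd_power_diff[of d 1 a j] dvd_power_diff[of d 1 a i]] by simp

theorem corollary1p3:
  fixes p \<alpha> \<beta> n :: nat and a r :: int
  assumes "prime p"
    and "\<alpha> > 1"
    and "\<alpha> \<ge> \<beta>"
    and "[a = 1] (mod int p ^ \<alpha>)"
    and "n \<ge> p ^ (\<alpha> - 1)"
    and "r < int p ^ \<beta>"
  shows "[(\<Sum>k | k \<le> n \<and> [int k = r] (mod int p ^ \<beta>).
            int (n choose k) * (-1) ^ k * a ^ nat ((int k - r) div int p ^ \<alpha>)) = 0]
         (mod int p ^ nat ((int n - int p ^ (\<alpha> - 1) - kronecker_delta \<beta> 0)
                             div int (totient (p ^ \<alpha>)) + int \<alpha> - int \<beta>))"
proof -
  define P where "P = p ^ \<alpha>"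
  define M where "M = p ^ (\<alpha> - 1)"
  define \<phi> where "\<phi> = M * (p - 1)"
  define w where "w m = (if [int m = r] (mod int p ^ \<beta>) then a ^ nat ((int m - r) div int P) else 0)" for m
  have p: "p \<ge> 2" using assms(1) prime_ge_2_nat by blast
  have P: "P > 0" and M: "M > 0" and \<phi>: "\<phi> > 0" using p by (auto simp: P_def M_def \<phi>_def)
  have tot: "totient (p ^ \<alpha>) = \<phi>"
    using assms(1,2) by (simp add: totient_prime_power \<phi>_def M_def)
  have nM: "M \<le> n" using assms(5) by (simp add: M_def)
  have a: "int p ^ \<alpha> dvd 1 - a"
    using assms(4) cong_iff_dvd_diff cong_sym by blast
  have nonneg: "(int m - r) div int P \<ge> 0" if "[int m = r] (mod int p ^ \<beta>)" for m
    using exponent_nonneg[OF assms(1,3,6) that] by (simp add: P_def)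
  have shift: "a ^ nat ((int (m + P) - r) div int P) = a * a ^ nat ((int m - r) div int P)"
    if "(int m - r) div int P \<ge> 0" for m
  proof -
    have "(int (m + P) - r) div int P = (int m - r) div int P + 1"
      using P div_add_self2[of "int P" "int m - r"] by (simp add: algebra_simps)
    then show ?thesis using that by (simp add: nat_add_distrib)
  qed
  have cong_shift: "[int (m + p ^ i) = r] (mod int p ^ j) \<longleftrightarrow> [int m = r] (mod int p ^ j)"
    if "j \<le> i" for m i j
  proof -
    have "int (m + p ^ i) - r = (int m - r) + int p ^ i" by simp
    then show ?thesis
      using le_imp_power_dvd[OF that, of "int p"] by (simp only: cong_iff_dvd_diff dvd_add_left_iff)
  qed
  have wP: "w (m + p ^ \<alpha>) = a * w m" for m
    using cong_shift[OF assms(3)] shift nonneg by (simp add: w_def P_def)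
  have S: "(\<Sum>k | k \<le> n \<and> [int k = r] (mod int p ^ \<beta>).
            int (n choose k) * (-1) ^ k * a ^ nat ((int k - r) div int p ^ \<alpha>)) = wsum w (one_minus_X 1 ^ n)"
    unfolding wsum_one_minus_X_power
    by (intro sum.mono_neutral_cong_left) (auto simp: w_def P_def)
  \<comment> \<open>Any exponent at least the required one suffices; this slack is used when \<beta>
    = 0 and n = p^(\<alpha>-1).\<close>
  have fin: ?thesis
    if "nat ((int n - int p ^ (\<alpha> - 1) - kronecker_delta \<beta> 0) div int (totient (p ^ \<alpha>)) + int \<alpha> - int \<beta>) \<le> e"
      "int p ^ e dvd wsum w (one_minus_X 1 ^ n)" for e
    unfolding S cong_0_iff using le_imp_power_dvd[OF that(1)] that(2) dvd_trans by blast
  show ?thesis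
  proof (cases "\<beta> = 0")
    case False
    define t where "t = (n - M) div \<phi>"
    have e: "nat ((int n - int p ^ (\<alpha> - 1) - kronecker_delta \<beta> 0) div int (totient (p ^ \<alpha>)) + int \<alpha> - int \<beta>)
       = t + (\<alpha> - \<beta>)"
    proof -
      have "int n - int p ^ (\<alpha> - 1) = int (n - M)" using nM by (simp add: M_def of_nat_diff)
      then have "(int n - int p ^ (\<alpha> - 1)) div int \<phi> = int t" by (simp add: t_def zdiv_int)
      then show ?thesis using False tot assms(3) by (simp add: kronecker_delta_def)
    qed
    have "t * \<phi> \<le> n - M" by (simp add: t_def)
    then have n: "p ^ (\<alpha> - 1) + t * (p ^ (\<alpha> - 1) * (p - 1)) \<le> n"
      using nM unfolding \<phi>_def M_def by linarith
    show ?thesis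
    proof (rule fin[OF eq_refl[OF e]], cases "\<beta> = \<alpha>")
      case True
      then show "int p ^ (t + (\<alpha> - \<beta>)) dvd wsum w (one_minus_X 1 ^ n)"
        using wsum_power_dvd_top[where w = w, OF assms(1,2) a wP n] by simp
    next
      case ne: False
      show "int p ^ (t + (\<alpha> - \<beta>)) dvd wsum w (one_minus_X 1 ^ n)"
      proof (rule wsum_power_dvd[where w = w, OF assms(1) _ _ order_refl a wP _ n])
        fix i m assume i: "\<beta> \<le> i" "i < \<alpha>"
        \<comment> \<open>As i is at least \<beta>, the shift keeps the residue class: both weights
          are 0 or both are powers of a, which is 1 modulo p^\<alpha>.\<close>
        have "int p ^ \<alpha> dvd w m - w (m + p ^ i)"
          unfolding w_def cong_shift[OF i(1)] using power_diff_dvd[OF a] by simp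
        then show "int p ^ (\<alpha> - \<beta>) dvd int p ^ (\<alpha> - 1 - i) * (w m - w (m + p ^ i))"
          by (meson diff_le_self dvd_mult dvd_trans le_imp_power_dvd)
      qed (use False ne assms(3) in auto)
    qed
  next
    case True
    \<comment> \<open>For \<beta> = 0 the congruence in \<open>w\<close> is vacuous, and consecutive
      weights differ only where the floor jumps, at m + 1 congruent to r modulo P. There the
      difference is a^q - a^(q+1) = (1 - a) a^q, which dictates \<open>w'\<close>.\<close>
    define w' where "w' m = (if [int m + 1 = r] (mod int P) then a ^ nat ((int m - r) div int P) else 0)" for m
    have r: "r \<le> 0" using assms(6) True by simp
    have w'P: "w' (m + p ^ \<alpha>) = a * w' m" for m
    proof -
      have "[int (m + P) + 1 = r] (mod int P) \<longleftrightarrow> [int m + 1 = r] (mod int P)"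
        using cong_shift[of \<alpha> \<alpha> "m + 1"] by (simp add: P_def algebra_simps)
      moreover have "(int m - r) div int P \<ge> 0" using r P by (simp add: pos_imp_zdiv_nonneg_iff)
      ultimately show ?thesis using shift by (simp add: w'_def P_def)
    qed
    have ww': "w m - w (m + 1) = (1 - a) * w' m" for m
    proof -
      define q s where "q = (int m - r) div int P" and "s = (int m - r) mod int P"
      have qs: "int m - r = q * int P + s" "0 \<le> s" "s < int P"
        using P by (simp_all add: q_def s_def)
      have q: "q \<ge> 0" using r P by (simp add: pos_imp_zdiv_nonneg_iff q_def)
      have m1: "int m + 1 - r = q * int P + (s + 1)" using qs by simp
      have c: "[int m + 1 = r] (mod int P) \<longleftrightarrow> s + 1 = int P"
      proof -
        have "[int m + 1 = r] (mod int P) \<longleftrightarrow> int P dvd s + 1"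
          unfolding cong_iff_dvd_diff m1 by (simp add: dvd_add_right_iff)
        also have "\<dots> \<longleftrightarrow> s + 1 = int P" using qs zdvd_imp_le[of "int P" "s + 1"] by auto
        finally show ?thesis .
      qed
      show ?thesis
      proof (cases "s + 1 = int P")
        case t: True
        have "(int m + 1 - r) div int P = q + 1" unfolding m1 t using P by simp
        then show ?thesis using True q t c
          by (simp add: w_def w'_def q_def[symmetric] nat_add_distrib algebra_simps)
      next
        case f: False
        have "(int m + 1 - r) div int P = q" unfolding m1 using qs f by (simp add: div_pos_pos_trivial)
        then show ?thesis using True f c
          by (simp add: w_def w'_def q_def[symmetric] algebra_simps)
      qed
    qed
    have n1: "n = Suc (n - 1)" using nM M by simp
    have W: "wsum w (one_minus_X 1 ^ n) = (1 - a) * wsum w' (one_minus_X 1 ^ (n - 1))"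
      by (subst n1) (simp only: power_Suc wsum_one_minus_X_mult ww' wsum_weight_mult)
    show ?thesis
    proof (cases "n = M")
      case True
      \<comment> \<open>Here n - 1 is below p^(\<alpha>-1), so no power of u can be exploited. The
        floor is -1, the required exponent is \<alpha> - 1, and the factor 1 - a alone
        suffices.\<close>
      have "(- 1) div int \<phi> = -1" using \<phi> by (simp add: div_eq_minus1)
      then have "(int n - int p ^ (\<alpha> - 1) - kronecker_delta \<beta> 0) div int (totient (p ^ \<alpha>)) = -1"
        using \<open>\<beta> = 0\<close> True tot by (simp add: kronecker_delta_def M_def)
      moreover have "int p ^ \<alpha> dvd wsum w (one_minus_X 1 ^ n)"
        unfolding W using a by (rule dvd_mult2)
      ultimately show ?thesis by (intro fin[of \<alpha>]) auto
    next
      case ne: False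
      \<comment> \<open>One factor u was spent on 1 - a, so n - 1 replaces n; 1 - a contributes
        p^\<alpha> and the rest p^t.\<close>
      define t where "t = (n - 1 - M) div \<phi>"
      have n: "p ^ (\<alpha> - 1) + t * (p ^ (\<alpha> - 1) * (p - 1)) \<le> n - 1"
      proof -
        have "t * \<phi> \<le> n - 1 - M" by (simp add: t_def)
        then show ?thesis using nM ne unfolding \<phi>_def M_def by linarith
      qed
      have "int n - int p ^ (\<alpha> - 1) - 1 = int (n - 1 - M)"
        using nM ne by (simp add: M_def of_nat_diff)
      then have "(int n - int p ^ (\<alpha> - 1) - 1) div int \<phi> = int t" by (simp add: t_def zdiv_int)
      moreover have "int p ^ (\<alpha> + t) dvd wsum w (one_minus_X 1 ^ n)"
        unfolding W power_add using a wsum_power_dvd_top[where w = w', OF assms(1,2) a w'P n] by (rule mult_dvd_mono)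
      ultimately show ?thesis
        using True tot by (intro fin[of "\<alpha> + t"]) (simp_all add: kronecker_delta_def)
    qed
  qed
qed

end
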